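(* Let $U,V$ be proper subsets of $S^3$ and let $\mathcal{U}\in\partial U$, $\mathcal{V}\in\partial V$. Assume that there exist $s\in(0,\tfrac12\pi)$ and a spherical cap $U(\mathcal{P},s)$, $\mathcal{P}\in S^3$, with $1\in\partial U(\mathcal{P},s)$ and with \[ \mathcal{U}^*U\subseteq U(\mathcal{P},s)\supseteq V\mathcal{V}^*. \] Then $\mathcal{U}\mathcal{V}\in\partial(U\otimes V)$.
   Context: $\mathbb{H}$ denotes the real quaternions, identified with $\mathbb{R}^4$ with its Euclidean inner product $\langle\cdot,\cdot\rangle$; $S^3\subset\mathbb{H}$ is the set of unit quaternions; $\mathcal{U}^*$ is the quaternionic conjugate. For subsets $A,B\subseteq\mathbb{H}$, $A\otimes B=\{ab:a\in A,\ b\in B\}$, and for a quaternion $\mathcal{Q}$, $\mathcal{Q}A=\{\mathcal{Q}a:a\in A\}$, $A\mathcal{Q}=\{a\mathcal{Q}:a\in A\}$. The symbol $\partial$ denotes boundary in the topology of $S^3$ induced by $\mathbb{R}^4$. For $\mathcal{P}\in S^3$ and $r\in[0,\pi]$, the spherical cap is $U(\mathcal{P},r):=\{\mathcal{W}\in S^3:\langle\mathcal{W},\mathcal{P}\rangle\ge\cos r\}$. *)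

theory Defs
  imports "HOL-Analysis.Analysis"
begin

text \<open>
  A quaternion $a + bi + cj + dk$ is the vector with components $(a,b,c,d)$ in real 4-space, with its
  library inner product, norm and topology. The library's \<open>*\<close> and \<open>1\<close> on vectors are
  componentwise and are \<^emph>\<open>not\<close> the quaternionic ones; use \<open>\<odot>\<close> and \<open>qone\<close>.
\<close>

type_synonym quat = "real ^ 4"

lemma vector_4 [simp]:
  "(vector [a, b, c, d] :: 'a::zero ^ 4) $ 1 = a"
  "(vector [a, b, c, d] :: 'a::zero ^ 4) $ 2 = b"
  "(vector [a, b, c, d] :: 'a::zero ^ 4) $ 3 = c"
  "(vector [a, b, c, d] :: 'a::zero ^ 4) $ 4 = d"
  unfolding vector_def by simp_all

definition qone :: quat where
  "qone = vector [1, 0, 0, 0]"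

definition qmult :: "quat \<Rightarrow> quat \<Rightarrow> quat" (infixl \<open>\<odot>\<close> 70) where
  "p \<odot> q = vector
     [p$1 * q$1 - p$2 * q$2 - p$3 * q$3 - p$4 * q$4,
      p$1 * q$2 + p$2 * q$1 + p$3 * q$4 - p$4 * q$3,
      p$1 * q$3 - p$2 * q$4 + p$3 * q$1 + p$4 * q$2,
      p$1 * q$4 + p$2 * q$3 - p$3 * q$2 + p$4 * q$1]"

definition qcnj :: "quat \<Rightarrow> quat" where
  "qcnj q = vector [q$1, - q$2, - q$3, - q$4]"

lemma qmult_units:
  defines "i \<equiv> vector [0, 1, 0, 0]" and "j \<equiv> vector [0, 0, 1, 0]" and "k \<equiv> vector [0, 0, 0, 1]"
  shows "i \<odot> i = - qone" "j \<odot> j = - qone" "k \<odot> k = - qone"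
    "i \<odot> j = k" "j \<odot> k = i" "k \<odot> i = j"
    "j \<odot> i = - k" "k \<odot> j = - i" "i \<odot> k = - j"
  by (simp_all add: assms qmult_def qone_def vec_eq_iff forall_4)

lemma qmult_qone [simp]: "qone \<odot> q = q" "q \<odot> qone = q"
  by (simp_all add: qmult_def qone_def vec_eq_iff forall_4)

lemma qmult_assoc: "(p \<odot> q) \<odot> r = p \<odot> (q \<odot> r)"
  by (simp add: qmult_def vec_eq_iff forall_4 algebra_simps)

lemma qmult_qcnj: "q \<odot> qcnj q = (norm q)\<^sup>2 *\<^sub>R qone"
  by (simp add: qmult_def qcnj_def qone_def vec_eq_iff forall_4 power2_norm_eq_inner
      inner_vec_def sum_4 algebra_simps)

definition qset_mult :: "quat set \<Rightarrow> quat set \<Rightarrow> quat set" (infixl \<open>\<otimes>\<close> 70) where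
  "A \<otimes> B = {a \<odot> b | a b. a \<in> A \<and> b \<in> B}"

abbreviation S3 :: "quat set" where
  "S3 \<equiv> sphere 0 1"

abbreviation S3_boundary :: "quat set \<Rightarrow> quat set" where
  "S3_boundary A \<equiv> top_of_set S3 frontier_of A"

text \<open>Intended for \<open>P \<in> S3\<close> and \<open>r \<in> {0..pi}\<close>.\<close>

definition spherical_cap :: "quat \<Rightarrow> real \<Rightarrow> quat set" where
  "spherical_cap P r = {W \<in> S3. W \<bullet> P \<ge> cos r}"

end

theory Submission
  imports Defs
begin

text \<open>
  Multiplying on the left by \<open>qcnj u\<close> and on the right by \<open>qcnj v\<close> moves \<open>u \<odot> v\<close> to \<open>qone\<close> and
  \<open>U \<otimes> V\<close> into \<open>C \<otimes> C\<close>, where \<open>C\<close> is the cap of radius \<open>s\<close> around \<open>P\<close>. That \<open>u \<odot> v\<close> lies in the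
  closure of \<open>U \<otimes> V\<close> is continuity of the product, so the point is that \<open>C \<otimes> C\<close> is not a
  neighbourhood of \<open>qone\<close> in the unit sphere.

  As \<open>qone\<close> is on the boundary of \<open>C\<close>, its angular distance from \<open>P\<close> is exactly \<open>s\<close>, that is,
  \<open>P = exp (s n)\<close> for a unit imaginary quaternion \<open>n\<close>. The points \<open>q = exp (- t n)\<close> with small \<open>t > 0\<close>
  escape from \<open>C\<close> along the great circle through \<open>P\<close> and \<open>qone\<close>, and no such point is a product
  \<open>a \<odot> b\<close> with \<open>a\<close> and \<open>b\<close> in \<open>C\<close>. Indeed, then \<open>a = q \<odot> qcnj b\<close> would be within distance \<open>s\<close> both of
  \<open>P = exp (s n)\<close> and of \<open>q \<odot> qcnj P = exp (- (s + t) n)\<close>; but these two centres are \<open>2 s + t\<close> apart,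
  so the two caps are disjoint (lemma \<open>caps_far_apart\<close>). Here \<open>s < pi / 2\<close> leaves room for \<open>t > 0\<close>
  with \<open>2 s + t \<le> pi\<close>.
\<close>

lemma qcnj_qcnj [simp]: "qcnj (qcnj q) = q"
  by (simp add: qcnj_def vec_eq_iff forall_4)

lemma norm_qcnj [simp]: "norm (qcnj q) = norm q"
  by (simp add: qcnj_def norm_eq_sqrt_inner inner_vec_def sum_4)

lemma qmult_qcnj_left: "qcnj q \<odot> q = (norm q)\<^sup>2 *\<^sub>R qone"
  using qmult_qcnj[of "qcnj q"] by simp

lemma inner_qmult_left: "(p \<odot> q) \<bullet> r = q \<bullet> (qcnj p \<odot> r)"
  by (simp add: qmult_def qcnj_def inner_vec_def sum_4 algebra_simps)

lemma inner_qmult_right: "(p \<odot> q) \<bullet> r = p \<bullet> (r \<odot> qcnj q)"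
  by (simp add: qmult_def qcnj_def inner_vec_def sum_4 algebra_simps)

lemma qmult_scaleR_left: "(c *\<^sub>R p) \<odot> q = c *\<^sub>R (p \<odot> q)"
  by (simp add: qmult_def vec_eq_iff forall_4 algebra_simps)

lemma norm_qmult: "norm (p \<odot> q) = norm p * norm q"
proof -
  have "(p \<odot> q) \<bullet> (p \<odot> q) = q \<bullet> ((qcnj p \<odot> p) \<odot> q)"
    by (simp add: inner_qmult_left qmult_assoc)
  also have "\<dots> = (norm p * norm q)\<^sup>2"
    by (simp add: qmult_qcnj_left qmult_scaleR_left power_mult_distrib power2_norm_eq_inner)
  finally show ?thesis
    by (simp add: norm_eq_sqrt_inner real_sqrt_mult)
qed

lemma continuous_on_qmult [continuous_intros]:
  assumes "continuous_on A f" and "continuous_on A g"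
  shows "continuous_on A (\<lambda>x. f x \<odot> g x)"
proof -
  have "continuous_on A (\<lambda>x. (f x \<odot> g x) $ i)" for i
    using exhaust_4[of i]
    by (elim disjE; simp add: qmult_def; intro continuous_intros assms)
  then have "continuous_on A (\<lambda>x. \<chi> i. (f x \<odot> g x) $ i)"
    by (rule continuous_on_vec_lambda)
  then show ?thesis
    by simp
qed

text \<open>The exponential \<open>exp (t n)\<close> in direction \<open>n\<close>; this formula is the exponential when \<open>n\<close> is a unit
  imaginary quaternion.\<close>

definition qexp :: "quat \<Rightarrow> real \<Rightarrow> quat" where
  "qexp n t = cos t *\<^sub>R qone + sin t *\<^sub>R n"

lemma qexp_0 [simp]: "qexp n 0 = qone"
  by (simp add: qexp_def)

lemma qcnj_qexp:
  assumes "n $ 1 = 0"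
  shows "qcnj (qexp n t) = qexp n (- t)"
  using assms by (simp add: qexp_def qcnj_def qone_def vec_eq_iff forall_4)

lemma inner_qexp:
  assumes "n $ 1 = 0" and "norm n = 1"
  shows "qexp n x \<bullet> qexp n y = cos (x - y)"
proof -
  have "qone \<bullet> n = 0" "n \<bullet> qone = 0" "qone \<bullet> qone = 1" "n \<bullet> n = 1"
    using assms by (simp_all add: qone_def inner_vec_def sum_4 norm_eq_1)
  then show ?thesis
    by (simp add: qexp_def inner_add_left inner_add_right cos_diff)
qed

lemma norm_qexp:
  assumes "n $ 1 = 0" and "norm n = 1"
  shows "norm (qexp n t) = 1"
  using inner_qexp[OF assms, of t t] by (simp add: norm_eq_1)

lemma qmult_qexp:
  assumes "n $ 1 = 0" and "norm n = 1"
  shows "qexp n x \<odot> qexp n y = qexp n (x + y)"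
proof -
  have "n $ 2 * n $ 2 + n $ 3 * n $ 3 + n $ 4 * n $ 4 = 1"
    using assms by (simp add: norm_eq_1 inner_vec_def sum_4)
  then have "n \<odot> n = - qone"
    using assms(1) by (simp add: qmult_def qone_def vec_eq_iff forall_4)
  moreover have "qexp n x \<odot> qexp n y
      = (cos x * cos y) *\<^sub>R qone + (cos x * sin y + sin x * cos y) *\<^sub>R n + (sin x * sin y) *\<^sub>R (n \<odot> n)"
    by (simp add: qexp_def qmult_def qone_def vec_eq_iff forall_4 algebra_simps)
  ultimately show ?thesis
    by (simp add: qexp_def cos_add sin_add algebra_simps)
qed

text \<open>The direction is the imaginary part of \<open>P\<close> divided by \<open>sin s\<close>. As the sign of \<open>sin s\<close> is free,
  any angle \<open>s\<close> whose cosine is the real part of \<open>P\<close> will do, once \<open>sin s \<noteq> 0\<close>.\<close>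

lemma unit_quaternion_polar:
  assumes "norm P = 1" and "P \<bullet> qone = cos s" and "sin s \<noteq> 0"
  obtains n where "n $ 1 = 0" and "norm n = 1" and "P = qexp n s"
proof
  define n where "n = (1 / sin s) *\<^sub>R (P - cos s *\<^sub>R qone)"
  have P1: "P $ 1 = cos s"
    using assms(2) by (simp add: qone_def inner_vec_def sum_4)
  then show "n $ 1 = 0"
    by (simp add: n_def qone_def)
  show "P = qexp n s"
    using assms(3) by (simp add: qexp_def n_def)
  have "(norm (P - cos s *\<^sub>R qone))\<^sup>2 = P \<bullet> P - 2 * cos s * (P \<bullet> qone) + (cos s)\<^sup>2 * (qone \<bullet> qone)"
    unfolding power2_norm_eq_inner
    by (simp add: inner_diff_left inner_diff_right inner_commute[of qone P]
        power2_eq_square algebra_simps)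
  also have "\<dots> = (sin s)\<^sup>2"
  proof -
    have "P \<bullet> P = 1" "qone \<bullet> qone = 1"
      using assms(1) by (simp_all add: norm_eq_1 qone_def inner_vec_def sum_4)
    then show ?thesis
      using assms(2) sin_cos_squared_add[of s] by (simp add: power2_eq_square algebra_simps)
  qed
  finally have "norm (P - cos s *\<^sub>R qone) = \<bar>sin s\<bar>"
    by (metis abs_norm_cancel power2_eq_iff_nonneg abs_ge_zero norm_ge_zero power2_abs)
  then show "norm n = 1"
    using assms(3) by (simp add: n_def)
qed

text \<open>A common point \<open>a\<close> of two caps of radius \<open>s\<close> would satisfy \<open>a \<bullet> (X + Y) \<ge> 2 * cos s\<close>, but \<open>X + Y\<close>
  has length \<open>2 * cos (d / 2)\<close>, where \<open>d\<close> is the angle between the centres. This replaces the triangle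
  inequality for angles by Cauchy-Schwarz.\<close>

lemma caps_far_apart:
  assumes "norm X = 1" and "norm Y = 1" and "cos s > 0" and "X \<bullet> Y < cos (2 * s)"
  shows "spherical_cap X s \<inter> spherical_cap Y s = {}"
proof (rule ccontr)
  assume "spherical_cap X s \<inter> spherical_cap Y s \<noteq> {}"
  then obtain a where a: "norm a = 1" "a \<bullet> X \<ge> cos s" "a \<bullet> Y \<ge> cos s"
    by (auto simp: spherical_cap_def)
  have "2 * cos s \<le> a \<bullet> (X + Y)"
    using a by (simp add: inner_add_right)
  also have "\<dots> \<le> norm (X + Y)"
    using norm_cauchy_schwarz[of a "X + Y"] a(1) by simp
  finally have "(2 * cos s)\<^sup>2 \<le> (norm (X + Y))\<^sup>2"
    using assms(3) by (intro power_mono) auto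
  also have "\<dots> = 2 + 2 * (X \<bullet> Y)"
    using assms(1,2)
    by (simp add: power2_norm_eq_inner inner_add_left inner_add_right inner_commute norm_eq_1)
  also have "\<dots> < 2 + 2 * cos (2 * s)"
    using assms(4) by simp
  also have "\<dots> = (2 * cos s)\<^sup>2"
    by (simp add: cos_double_cos power_mult_distrib)
  finally show False
    by simp
qed

text \<open>If \<open>q = a \<odot> b\<close> with \<open>a\<close> and \<open>b\<close> unit, then \<open>b \<bullet> P = a \<bullet> (q \<odot> qcnj P)\<close>, so \<open>b\<close> lying in the cap
  around \<open>P\<close> puts \<open>a\<close> in the cap around \<open>q \<odot> qcnj P\<close>, which for \<open>q = exp (- t n)\<close> is too far from \<open>P\<close>.\<close>

lemma qexp_notin_cap_product:
  assumes n: "n $ 1 = 0" "norm n = 1"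
    and s: "0 < s" "s < pi / 2" and t: "0 < t" "2 * s + t \<le> pi"
  shows "qexp n (- t) \<notin> spherical_cap (qexp n s) s \<otimes> spherical_cap (qexp n s) s"
proof
  assume "qexp n (- t) \<in> spherical_cap (qexp n s) s \<otimes> spherical_cap (qexp n s) s"
  then obtain a b where ab: "qexp n (- t) = a \<odot> b"
    and a: "a \<in> spherical_cap (qexp n s) s" and b: "b \<in> spherical_cap (qexp n s) s"
    by (auto simp: qset_mult_def)
  have "norm a = 1"
    using a by (simp add: spherical_cap_def)
  then have "b = qcnj a \<odot> qexp n (- t)"
    by (simp add: ab qmult_assoc[symmetric] qmult_qcnj_left)
  then have "b \<bullet> qexp n s = qexp n (- t) \<bullet> (a \<odot> qexp n s)"
    by (simp add: inner_qmult_left)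
  also have "\<dots> = a \<bullet> (qexp n (- t) \<odot> qcnj (qexp n s))"
    by (simp add: inner_commute[of "qexp n (- t)"] inner_qmult_right)
  also have "\<dots> = a \<bullet> qexp n (- (s + t))"
    using n by (simp add: qcnj_qexp qmult_qexp add.commute)
  finally have "a \<in> spherical_cap (qexp n (- (s + t))) s"
    using a b by (simp add: spherical_cap_def)
  moreover have "spherical_cap (qexp n s) s \<inter> spherical_cap (qexp n (- (s + t))) s = {}"
  proof (rule caps_far_apart)
    have "cos (2 * s + t) < cos (2 * s)"
      using s t by (intro cos_monotone_0_pi) auto
    then show "qexp n s \<bullet> qexp n (- (s + t)) < cos (2 * s)"
      using n by (simp add: inner_qexp algebra_simps)
    show "cos s > 0"
      using s by (intro cos_gt_zero) auto
  qed (use n norm_qexp in auto)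
  ultimately show False
    using a by blast
qed

text \<open>The closed half-space \<open>W \<bullet> P \<ge> cos r\<close> contains the closure of the cap, and the open half-space
  \<open>W \<bullet> P > cos r\<close> meets the sphere inside the interior of the cap.\<close>

lemma frontier_spherical_cap_imp_inner_eq:
  assumes "x \<in> S3_boundary (spherical_cap P r)"
  shows "x \<bullet> P = cos r"
proof (rule antisym)
  have sub: "spherical_cap P r \<subseteq> {W. W \<bullet> P \<ge> cos r}"
    by (auto simp: spherical_cap_def)
  have "closed {W. W \<bullet> P \<ge> cos r}"
    by (intro closed_Collect_le continuous_intros)
  then have "closure (spherical_cap P r) \<subseteq> {W. W \<bullet> P \<ge> cos r}"
    using sub by (rule closure_minimal[rotated])
  moreover have "x \<in> S3 \<inter> closure (S3 \<inter> spherical_cap P r)"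
    using assms by (simp add: frontier_of_def closure_of_subtopology)
  ultimately show "cos r \<le> x \<bullet> P"
    using closure_mono[of "S3 \<inter> spherical_cap P r" "spherical_cap P r"] by blast
  show "x \<bullet> P \<le> cos r"
  proof (rule ccontr)
    assume "\<not> x \<bullet> P \<le> cos r"
    then have x: "x \<in> S3 \<inter> {W. W \<bullet> P > cos r}"
      using \<open>x \<in> S3 \<inter> closure _\<close> by auto
    have "open {W. W \<bullet> P > cos r}"
      by (intro open_Collect_less continuous_intros)
    then have "openin (top_of_set S3) (S3 \<inter> {W. W \<bullet> P > cos r})"
      by (rule openin_open_Int)
    moreover have "S3 \<inter> {W. W \<bullet> P > cos r} \<subseteq> spherical_cap P r"
      by (auto simp: spherical_cap_def)
    ultimately have "x \<in> top_of_set S3 interior_of spherical_cap P r"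
      using x by (auto simp: interior_of_def)
    then show False
      using assms by (simp add: frontier_of_def)
  qed
qed

lemma closure_qset_mult:
  assumes "u \<in> closure U" and "v \<in> closure V"
  shows "u \<odot> v \<in> closure (U \<otimes> V)"
proof -
  let ?f = "\<lambda>z. fst z \<odot> snd z"
  have "?f ` closure (U \<times> V) \<subseteq> closure (U \<otimes> V)"
  proof (rule image_closure_subset)
    show "continuous_on (closure (U \<times> V)) ?f"
      by (intro continuous_intros)
    have "?f ` (U \<times> V) \<subseteq> U \<otimes> V"
      unfolding qset_mult_def by force
    then show "?f ` (U \<times> V) \<subseteq> closure (U \<otimes> V)"
      using closure_subset by blast
  qed simp
  then show ?thesis
    using assms by (force simp: closure_Times)
qed

theorem theorem5:
  fixes U V :: "quat set" and u v :: quat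
  assumes "U \<subset> S3" and "V \<subset> S3"
    and "u \<in> S3_boundary U" and "v \<in> S3_boundary V"
    and "\<exists>s \<in> {0 <..< pi / 2}. \<exists>P \<in> S3.
           qone \<in> S3_boundary (spherical_cap P s) \<and>
           (\<lambda>a. qcnj u \<odot> a) ` U \<subseteq> spherical_cap P s \<and>
           (\<lambda>b. b \<odot> qcnj v) ` V \<subseteq> spherical_cap P s"
  shows "u \<odot> v \<in> S3_boundary (U \<otimes> V)"
proof -
  obtain s P where s: "0 < s" "s < pi / 2" and P: "norm P = 1"
    and one: "qone \<in> S3_boundary (spherical_cap P s)"
    and U: "(\<lambda>a. qcnj u \<odot> a) ` U \<subseteq> spherical_cap P s"
    and V: "(\<lambda>b. b \<odot> qcnj v) ` V \<subseteq> spherical_cap P s"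
    using assms(5) by auto
  have "P \<bullet> qone = cos s"
    using frontier_spherical_cap_imp_inner_eq[OF one] by (simp add: inner_commute)
  moreover have "sin s > 0"
    using s by (intro sin_gt_zero) auto
  ultimately obtain n where n: "n $ 1 = 0" "norm n = 1" and Pn: "P = qexp n s"
    using unit_quaternion_polar[OF P] by (metis less_irrefl)
  have u: "norm u = 1" "u \<in> closure U" and v: "norm v = 1" "v \<in> closure V"
    using assms(1-4) by (auto simp: frontier_of_def closure_of_subtopology Int_absorb1 psubset_imp_subset)
  have UV: "U \<otimes> V \<subseteq> S3"
    using psubset_imp_subset[OF assms(1)] psubset_imp_subset[OF assms(2)]
    by (force simp: qset_mult_def norm_qmult)

  have "u \<odot> v \<in> top_of_set S3 closure_of (U \<otimes> V)"
    using closure_qset_mult[OF u(2) v(2)] u(1) v(1) UV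
    by (simp add: closure_of_subtopology Int_absorb1 norm_qmult)
  moreover have "u \<odot> v \<notin> top_of_set S3 interior_of (U \<otimes> V)"
  proof
    assume "u \<odot> v \<in> top_of_set S3 interior_of (U \<otimes> V)"
    then obtain W where W: "open W" "u \<odot> v \<in> W" "S3 \<inter> W \<subseteq> U \<otimes> V"
      by (auto simp: interior_of_def openin_open)
    let ?g = "\<lambda>t. u \<odot> qexp n (- t) \<odot> v"
    have "continuous_on UNIV ?g"
      unfolding qexp_def by (intro continuous_intros)
    then have "open (?g -` W)"
      using W(1) by (simp add: continuous_on_open_vimage)
    moreover have "0 \<in> ?g -` W"
      using W(2) by simp
    ultimately obtain e where e: "e > 0" "ball 0 e \<subseteq> ?g -` W"
      by (meson open_contains_ball)
    \<comment> \<open>The first bound keeps \<open>u \<odot> exp (- t n) \<odot> v\<close> in \<open>W\<close>; the second keeps the centres of the two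
      caps at most \<open>pi\<close> apart, so that a larger angle means a smaller cosine.\<close>
    define t where "t = min (e / 2) (pi - 2 * s)"
    have t: "0 < t" "2 * s + t \<le> pi" and "t < e"
      using e(1) s by (auto simp: t_def)
    then have "?g t \<in> S3 \<inter> W"
      using e(2) u(1) v(1) n by (auto simp: norm_qmult norm_qexp subset_iff)
    then obtain a b where ab: "?g t = a \<odot> b" "a \<in> U" "b \<in> V"
      using W(3) by (auto simp: qset_mult_def)
    have "qexp n (- t) = qcnj u \<odot> ?g t \<odot> qcnj v"
    proof -
      have "qcnj u \<odot> ?g t \<odot> qcnj v = (qcnj u \<odot> u) \<odot> qexp n (- t) \<odot> (v \<odot> qcnj v)"
        by (simp only: qmult_assoc)
      then show ?thesis
        using u(1) v(1) by (simp add: qmult_qcnj qmult_qcnj_left)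
    qed
    also have "\<dots> = (qcnj u \<odot> a) \<odot> (b \<odot> qcnj v)"
      unfolding ab(1) by (simp only: qmult_assoc)
    finally have "qexp n (- t) \<in> spherical_cap P s \<otimes> spherical_cap P s"
      using U V ab(2,3) unfolding qset_mult_def by blast
    then show False
      using qexp_notin_cap_product[OF n s t] by (simp add: Pn)
  qed
  ultimately show ?thesis
    by (simp add: frontier_of_def)
qed

end
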